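(* Let $X$ be a rotation-invariant Banach space of functions on $\mathbb{R}^n$, let $T$ be a singular integral operator with kernel $K$, let $\boldsymbol\alpha=(\alpha_1,\dots,\alpha_n)\in\mathbb{R}^n$ with $\alpha_k\notin\pi\mathbb{Z}$ for $k=1,\dots,n$, and let $T_{\boldsymbol\alpha}$ be the associated singular integral operator with chirp functions. Then $T$ is bounded from $X$ to $X$ if and only if $T_{\boldsymbol\alpha}$ is bounded from $X$ to $X$.
   Context: For $\boldsymbol\alpha\in\mathbb{R}^n$ with all $\alpha_k\notin\pi\mathbb{Z}$, the chirp is $e_{\boldsymbol\alpha}(\boldsymbol x)=\exp\big(\tfrac{i}{2}\sum_{k=1}^n x_k^2\cot\alpha_k\big)$, so $e_{-\boldsymbol\alpha}=1/e_{\boldsymbol\alpha}$. A Banach space $(X,\|\cdot\|_X)$ (of functions on $\mathbb{R}^n$) is called rotation-invariant if, for every $f\in X$ and every $\boldsymbol\alpha\in\mathbb{R}^n$ with all $\alpha_k\notin\pi\mathbb{Z}$, one has $e_{\boldsymbol\alpha}f\in X$ and $\|e_{\boldsymbol\alpha}f\|_X=\|f\|_X$. The singular integral operator with kernel $K$ is the linear operator $$T(f)(\boldsymbol x)=\mathrm{p.v.}\int_{\mathbb{R}^n}K(\boldsymbol x,\boldsymbol y)f(\boldsymbol y)\,d\boldsymbol y,$$ and the associated operator with chirp functions is $$T_{\boldsymbol\alpha}(f)(\boldsymbol x)=\mathrm{p.v.}\int_{\mathbb{R}^n}e_{-\boldsymbol\alpha}(\boldsymbol x)K(\boldsymbol x,\boldsymbol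 y)e_{\boldsymbol\alpha}(\boldsymbol y)f(\boldsymbol y)\,d\boldsymbol y,$$ that is, $T_{\boldsymbol\alpha}f=e_{-\boldsymbol\alpha}\,T(e_{\boldsymbol\alpha}f)$. An operator $A$ is bounded from $X$ to $X$ if it is defined on $X$, maps $X$ into $X$, and there is $C>0$ with $\|Af\|_X\le C\|f\|_X$ for all $f\in X$. *)

theory Defs
  imports "HOL-Analysis.Analysis"
begin

definition admissible_angles :: "real ^ 'n \<Rightarrow> bool" where
  "admissible_angles \<alpha> \<longleftrightarrow> (\<forall>k. \<alpha> $ k \<notin> range (\<lambda>m::int. pi * of_int m))"

definition chirp :: "real ^ 'n \<Rightarrow> real ^ 'n \<Rightarrow> complex" where
  "chirp \<alpha> x = exp (\<i> / 2 * complex_of_real (\<Sum>k\<in>UNIV. (x $ k)\<^sup>2 * cot (\<alpha> $ k)))"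

(* As usual for spaces such as L^p, functions are identified when they agree Lebesgue-almost
   everywhere. The space of equivalence classes is encoded by the set X of all representatives
   (whence ae_closed), and the norm by a function N on representatives that vanishes exactly on
   the class of 0. The triangle inequality makes N constant on classes. *)
locale banach_function_space =
  fixes X :: "(real ^ 'n \<Rightarrow> complex) set"
    and N :: "(real ^ 'n \<Rightarrow> complex) \<Rightarrow> real"
  assumes zero_mem: "(\<lambda>x. 0) \<in> X"
    and add_mem: "f \<in> X \<Longrightarrow> g \<in> X \<Longrightarrow> (\<lambda>x. f x + g x) \<in> X"
    and scale_mem: "f \<in> X \<Longrightarrow> (\<lambda>x. c * f x) \<in> X"
    and ae_closed: "f \<in> X \<Longrightarrow> (AE x in lebesgue. g x = f x) \<Longrightarrow> g \<in> X"
    and norm_nonneg: "f \<in> X \<Longrightarrow> 0 \<le> N f"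
    and norm_eq_zero: "f \<in> X \<Longrightarrow> N f = 0 \<longleftrightarrow> (AE x in lebesgue. f x = 0)"
    and norm_triangle: "f \<in> X \<Longrightarrow> g \<in> X \<Longrightarrow> N (\<lambda>x. f x + g x) \<le> N f + N g"
    and norm_scale: "f \<in> X \<Longrightarrow> N (\<lambda>x. c * f x) = cmod c * N f"
    and complete:
      "(\<And>i::nat. F i \<in> X) \<Longrightarrow>
       (\<And>e. e > 0 \<Longrightarrow> \<exists>M. \<forall>i\<ge>M. \<forall>j\<ge>M. N (\<lambda>x. F i x - F j x) < e) \<Longrightarrow>
       \<exists>f\<in>X. (\<lambda>i. N (\<lambda>x. F i x - f x)) \<longlonglongrightarrow> 0"

definition rotation_invariant ::
  "(real ^ 'n \<Rightarrow> complex) set \<Rightarrow> ((real ^ 'n \<Rightarrow> complex) \<Rightarrow> real) \<Rightarrow> bool" where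
  "rotation_invariant X N \<longleftrightarrow>
     (\<forall>f\<in>X. \<forall>\<alpha>. admissible_angles \<alpha> \<longrightarrow>
        (\<lambda>x. chirp \<alpha> x * f x) \<in> X \<and> N (\<lambda>x. chirp \<alpha> x * f x) = N f)"

definition truncated_integral :: "(real ^ 'n \<Rightarrow> complex) \<Rightarrow> real ^ 'n \<Rightarrow> real \<Rightarrow> complex" where
  "truncated_integral g x e = (LINT y:{y. e < dist x y}|lebesgue. g y)"

(* Existence of p.v. \<integral> g(y) dy with singularity at x. *)
definition pv_exists :: "(real ^ 'n \<Rightarrow> complex) \<Rightarrow> real ^ 'n \<Rightarrow> bool" where
  "pv_exists g x \<longleftrightarrow>
     (\<forall>e>0. set_integrable lebesgue {y. e < dist x y} g) \<and>
     (\<exists>l. (truncated_integral g x \<longlongrightarrow> l) (at_right 0))"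

definition pv_integral :: "(real ^ 'n \<Rightarrow> complex) \<Rightarrow> real ^ 'n \<Rightarrow> complex" where
  "pv_integral g x = Lim (at_right 0) (truncated_integral g x)"

(* The value at the points where the principal value fails to exist is unspecified;
   for f in sio_domain K these points form a null set. *)
definition sio ::
  "(real ^ 'n \<Rightarrow> real ^ 'n \<Rightarrow> complex) \<Rightarrow> (real ^ 'n \<Rightarrow> complex) \<Rightarrow> real ^ 'n \<Rightarrow> complex" where
  "sio K f x = pv_integral (\<lambda>y. K x y * f y) x"

definition sio_domain ::
  "(real ^ 'n \<Rightarrow> real ^ 'n \<Rightarrow> complex) \<Rightarrow> (real ^ 'n \<Rightarrow> complex) set" where
  "sio_domain K = {f. AE x in lebesgue. pv_exists (\<lambda>y. K x y * f y) x}"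

definition chirp_kernel ::
  "real ^ 'n \<Rightarrow> (real ^ 'n \<Rightarrow> real ^ 'n \<Rightarrow> complex) \<Rightarrow> real ^ 'n \<Rightarrow> real ^ 'n \<Rightarrow> complex" where
  "chirp_kernel \<alpha> K x y = chirp (- \<alpha>) x * K x y * chirp \<alpha> y"

(* D is the domain of definition of the operator A. *)
definition bounded_operator_on ::
  "'f set \<Rightarrow> ('f \<Rightarrow> real) \<Rightarrow> 'f set \<Rightarrow> ('f \<Rightarrow> 'f) \<Rightarrow> bool" where
  "bounded_operator_on X N D A \<longleftrightarrow>
     X \<subseteq> D \<and> A ` X \<subseteq> X \<and> (\<exists>C>0. \<forall>f\<in>X. N (A f) \<le> C * N f)"

end

theory Submission
  imports Defs
begin

text \<open>
  The factor \<^term>\<open>chirp (- \<alpha>) x\<close> of the conjugated kernel does not depend on the variable of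
  integration and leaves the principal value wherever the latter exists, so that
  \<open>T\<^sub>\<alpha> f = chirp (- \<alpha>) * T (chirp \<alpha> * f)\<close> almost everywhere. Multiplication by a chirp preserves
  both \<^term>\<open>X\<close> and its norm, by rotation invariance, so a bound for \<open>T\<close> is a bound for \<open>T\<^sub>\<alpha>\<close>, with
  the same constant. This is \<open>bounded_operator_on_chirp_kernel\<close>.

  The two chirps at \<^term>\<open>\<alpha>\<close> and \<^term>\<open>- \<alpha>\<close> are reciprocal, hence conjugating \<open>T\<^sub>\<alpha>\<close> in the same
  way with \<^term>\<open>- \<alpha>\<close> returns \<open>T\<close> (\<open>chirp_kernel_uminus_cancel\<close>), and the converse is the same
  implication for the kernel of \<open>T\<^sub>\<alpha>\<close> and the angles \<^term>\<open>- \<alpha>\<close>.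

  The identity relating \<open>T\<close> and \<open>T\<^sub>\<alpha>\<close> can fail where a principal value does not exist. These points
  form a null set, and neither membership in \<^term>\<open>X\<close> nor the norm depends on the representative
  of a class (\<open>norm_cong_AE\<close>).
\<close>

lemma admissible_angles_uminus:
  assumes "admissible_angles \<alpha>"
  shows "admissible_angles (- \<alpha>)"
  unfolding admissible_angles_def
proof (intro allI notI)
  fix k
  assume "(- \<alpha>) $ k \<in> range (\<lambda>m::int. pi * of_int m)"
  then obtain m :: int where "(- \<alpha>) $ k = pi * of_int m"
    by auto
  then have "\<alpha> $ k = pi * of_int (- m)"
    by simp
  then have "\<alpha> $ k \<in> range (\<lambda>m::int. pi * of_int m)"
    by (rule range_eqI)
  with assms show False
    by (simp add: admissible_angles_def)
qed

lemma chirp_uminus_mult: "chirp (- \<alpha>) x * chirp \<alpha> x = 1"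
proof -
  have cot_uminus: "cot (- t) = - cot t" for t :: real
    by (simp add: cot_def)
  show ?thesis
    by (simp add: chirp_def cot_uminus sum_negf flip: exp_add)
qed

lemma chirp_kernel_uminus_cancel: "chirp_kernel (- \<alpha>) (chirp_kernel \<alpha> K) = K"
proof (intro ext)
  fix x y
  have "chirp_kernel (- \<alpha>) (chirp_kernel \<alpha> K) x y
      = (chirp (- \<alpha>) x * chirp \<alpha> x) * K x y * (chirp (- \<alpha>) y * chirp \<alpha> y)"
    by (simp add: chirp_kernel_def mult_ac)
  then show "chirp_kernel (- \<alpha>) (chirp_kernel \<alpha> K) x y = K x y"
    by (simp add: chirp_uminus_mult)
qed

lemma truncated_integral_mult_left:
  "truncated_integral (\<lambda>y. c * g y) x = (\<lambda>e. c * truncated_integral g x e)"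
  by (simp add: truncated_integral_def fun_eq_iff)

lemma pv_exists_mult_left:
  assumes "pv_exists g x"
  shows "pv_exists (\<lambda>y. c * g y) x"
  using assms unfolding pv_exists_def truncated_integral_mult_left
  by (auto intro: tendsto_mult_left)

lemma pv_integral_mult_left:
  assumes "pv_exists g x"
  shows "pv_integral (\<lambda>y. c * g y) x = c * pv_integral g x"
proof -
  from assms obtain l where l: "(truncated_integral g x \<longlongrightarrow> l) (at_right 0)"
    by (auto simp: pv_exists_def)
  then have "((\<lambda>e. c * truncated_integral g x e) \<longlongrightarrow> c * l) (at_right 0)"
    by (rule tendsto_mult_left)
  with l show ?thesis
    by (simp add: pv_integral_def truncated_integral_mult_left tendsto_Lim)
qed

text \<open>
  The norm axioms speak of null functions only; that almost equal functions have equal norms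
  comes from applying the triangle inequality to their null difference, once in each direction.
\<close>
lemma (in banach_function_space) norm_cong_AE:
  assumes "f \<in> X" and "g \<in> X" and "AE x in lebesgue. f x = g x"
  shows "N f = N g"
proof -
  have le: "N u \<le> N v"
    if "u \<in> X" "v \<in> X" and ae: "AE x in lebesgue. u x = v x" for u v
  proof -
    define d where "d = (\<lambda>x. u x - v x)"
    have d0: "AE x in lebesgue. d x = 0"
      using ae by (auto simp: d_def)
    then have "d \<in> X"
      using ae_closed[OF zero_mem] by blast
    then have "N d = 0"
      using d0 norm_eq_zero by blast
    moreover have "N (\<lambda>x. v x + d x) \<le> N v + N d"
      using \<open>v \<in> X\<close> \<open>d \<in> X\<close> by (rule norm_triangle)
    ultimately show ?thesis
      by (simp add: d_def)
  qed
  have "AE x in lebesgue. g x = f x"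
    using assms(3) by auto
  with assms show ?thesis
    by (intro antisym le)
qed

lemma chirp_kernel_apply:
  "chirp_kernel \<alpha> K x y * f y = chirp (- \<alpha>) x * (K x y * (chirp \<alpha> y * f y))"
  by (simp add: chirp_kernel_def mult_ac)

lemma sio_domain_chirp_kernel:
  assumes "(\<lambda>y. chirp \<alpha> y * f y) \<in> sio_domain K"
  shows "f \<in> sio_domain (chirp_kernel \<alpha> K)"
  using assms unfolding sio_domain_def chirp_kernel_apply
  by (auto elim!: eventually_mono intro: pv_exists_mult_left)

text \<open>
  The conjugation identity holds wherever the principal value of the modulated function exists,
  since the scalar \<^term>\<open>chirp (- \<alpha>) x\<close> passes through an existing limit. Elsewhere the value of
  the limit is unspecified, which is why the identity is only claimed almost everywhere.
\<close>
lemma sio_chirp_kernel_AE: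
  assumes "(\<lambda>y. chirp \<alpha> y * f y) \<in> sio_domain K"
  shows "AE x in lebesgue.
    sio (chirp_kernel \<alpha> K) f x = chirp (- \<alpha>) x * sio K (\<lambda>y. chirp \<alpha> y * f y) x"
  using assms unfolding sio_domain_def sio_def chirp_kernel_apply
  by (auto elim!: eventually_mono intro: pv_integral_mult_left)

text \<open>
  Boundedness passes through the three factors of the conjugated operator: both multiplications
  are isometries of \<^term>\<open>X\<close>, and the operator between them is bounded by assumption.
\<close>
lemma bounded_operator_on_chirp_kernel:
  assumes "banach_function_space X N"
    and rot: "rotation_invariant X N"
    and adm: "admissible_angles \<alpha>"
    and bdd: "bounded_operator_on X N (sio_domain K) (sio K)"
  shows "bounded_operator_on X N (sio_domain (chirp_kernel \<alpha> K)) (sio (chirp_kernel \<alpha> K))"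
proof -
  interpret banach_function_space X N
    by fact
  from bdd obtain C where C: "C > 0" "\<And>f. f \<in> X \<Longrightarrow> N (sio K f) \<le> C * N f"
    and dom: "X \<subseteq> sio_domain K" and maps: "sio K ` X \<subseteq> X"
    by (auto simp: bounded_operator_on_def)
  have main: "f \<in> sio_domain (chirp_kernel \<alpha> K) \<and> sio (chirp_kernel \<alpha> K) f \<in> X \<and>
      N (sio (chirp_kernel \<alpha> K) f) \<le> C * N f" if "f \<in> X" for f
  proof -
    define h where "h = (\<lambda>y. chirp \<alpha> y * f y)"
    define g where "g = (\<lambda>x. chirp (- \<alpha>) x * sio K h x)"
    have h: "h \<in> X" "N h = N f"
      using rot adm \<open>f \<in> X\<close> by (auto simp: rotation_invariant_def h_def)
    have "sio K h \<in> X"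
      using maps h by blast
    then have g: "g \<in> X" "N g = N (sio K h)"
      using rot admissible_angles_uminus[OF adm] by (auto simp: rotation_invariant_def g_def)
    have h_dom: "(\<lambda>y. chirp \<alpha> y * f y) \<in> sio_domain K"
      using dom h by (auto simp: h_def)
    have ae: "AE x in lebesgue. sio (chirp_kernel \<alpha> K) f x = g x"
      using sio_chirp_kernel_AE[OF h_dom] by (simp add: g_def h_def)
    have in_X: "sio (chirp_kernel \<alpha> K) f \<in> X"
      using g(1) ae by (rule ae_closed)
    have "N (sio (chirp_kernel \<alpha> K) f) = N (sio K h)"
      using norm_cong_AE[OF in_X g(1) ae] g(2) by simp
    also have "\<dots> \<le> C * N f"
      using C(2)[OF h(1)] h(2) by simp
    finally show ?thesis
      using sio_domain_chirp_kernel[OF h_dom] in_X by blast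
  qed
  with C(1) show ?thesis
    unfolding bounded_operator_on_def by blast
qed

theorem theorem2p6:
  fixes X :: "(real ^ 'n \<Rightarrow> complex) set"
    and N :: "(real ^ 'n \<Rightarrow> complex) \<Rightarrow> real"
    and K :: "real ^ 'n \<Rightarrow> real ^ 'n \<Rightarrow> complex"
    and \<alpha> :: "real ^ 'n"
  assumes "banach_function_space X N"
    and "rotation_invariant X N"
    and "admissible_angles \<alpha>"
  shows "bounded_operator_on X N (sio_domain K) (sio K) \<longleftrightarrow>
         bounded_operator_on X N (sio_domain (chirp_kernel \<alpha> K)) (sio (chirp_kernel \<alpha> K))"
proof
  assume "bounded_operator_on X N (sio_domain K) (sio K)"
  with assms
  show "bounded_operator_on X N (sio_domain (chirp_kernel \<alpha> K)) (sio (chirp_kernel \<alpha> K))"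
    by (rule bounded_operator_on_chirp_kernel)
next
  assume "bounded_operator_on X N (sio_domain (chirp_kernel \<alpha> K)) (sio (chirp_kernel \<alpha> K))"
  with assms(1,2) admissible_angles_uminus[OF assms(3)]
  have "bounded_operator_on X N (sio_domain (chirp_kernel (- \<alpha>) (chirp_kernel \<alpha> K)))
    (sio (chirp_kernel (- \<alpha>) (chirp_kernel \<alpha> K)))"
    by (rule bounded_operator_on_chirp_kernel)
  then show "bounded_operator_on X N (sio_domain K) (sio K)"
    by (simp only: chirp_kernel_uminus_cancel)
qed

end
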